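(* Let $E\subset\mathbb{R}^2$ be an ellipse centered at $0$. If $A\subset\mathbb{R}^2$ is a convex set containing more than one point, and if $B\subset\mathbb{R}^2$ is a nonconvex set such that $$d^{(E)}(A+B)=d^{(E)}(B),$$ then either $\mathrm{aff}(A)$ and $\mathrm{aff}(B)$ are $E$-orthogonal lines, or $\dim(B)=2$.
   Context: An ellipse centered at $0$ is a set of the form $E=T^{-1}B_2^2$, where $B_2^2$ is the closed Euclidean unit disc in $\mathbb{R}^2$ and $T:\mathbb{R}^2\to\mathbb{R}^2$ is an invertible linear map. The norm with closed unit ball $E$ is $\|x\|_E:=\inf\{\lambda>0: x\in\lambda E\}$. For any nonempty set $S\subset\mathbb{R}^2$, $$d^{(E)}(S):=\sup_{x\in\mathrm{conv}(S)}\ \inf_{s\in S}\|x-s\|_E,$$ where $\mathrm{conv}(S)$ is the convex hull of $S$. The sum $A+B:=\{a+b: a\in A,\ b\in B\}$ is the Minkowski sum, $\mathrm{aff}(S)$ denotes the affine hull of $S$, and $\dim(S)$ denotes the dimension of $\mathrm{aff}(S)$. Two lines $L_1,L_2\subset\mathbb{R}^2$ are called $E$-orthogonal if the lines $TL_1$ and $TL_2$ are orthogonal (in the Euclidean sense), where $T$ is any invertible linear transformation such that $TE=B_2^2$; this does not depend on the choice of $T$.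
   Formalization: The formal theorem additionally assumes 0 < d^(E)(B) < ∞ (automatic for compact nonconvex B); without it the claim fails, e.g. for A=[0,1] and B=[0,1]∖{1/2}, or B={2^n}, on one line. *)

theory Defs
  imports "HOL-Analysis.Analysis"
begin

definition centered_ellipse :: "(real^2) set \<Rightarrow> bool" where
  "centered_ellipse E \<longleftrightarrow> (\<exists>T :: real^2 \<Rightarrow> real^2. linear T \<and> bij T \<and> E = T -` cball 0 1)"

definition ellipse_norm :: "(real^2) set \<Rightarrow> real^2 \<Rightarrow> real" where
  "ellipse_norm E x = Inf {r. r > 0 \<and> x \<in> (\<lambda>y. r *\<^sub>R y) ` E}"

text \<open>
  The distance from the convex hull takes values in the extended reals, since the supremum may be
  infinite for an unbounded set. Only nonempty sets are meaningful arguments.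
\<close>

definition hull_dist :: "(real^2) set \<Rightarrow> (real^2) set \<Rightarrow> ereal" where
  "hull_dist E S = (SUP x\<in>convex hull S. INF s\<in>S. ereal (ellipse_norm E (x - s)))"

definition is_line :: "(real^2) set \<Rightarrow> bool" where
  "is_line L \<longleftrightarrow> affine L \<and> aff_dim L = 1"

definition orthogonal_lines :: "(real^2) set \<Rightarrow> (real^2) set \<Rightarrow> bool" where
  "orthogonal_lines L M \<longleftrightarrow> is_line L \<and> is_line M \<and>
     (\<forall>x\<in>L. \<forall>y\<in>L. \<forall>u\<in>M. \<forall>v\<in>M. orthogonal (x - y) (u - v))"

text \<open>
  For an ellipse \<open>E\<close> at least one such \<open>T\<close> exists, so the universal quantifier is not vacuous.
\<close>

definition E_orthogonal_lines :: "(real^2) set \<Rightarrow> (real^2) set \<Rightarrow> (real^2) set \<Rightarrow> bool" where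
  "E_orthogonal_lines E L M \<longleftrightarrow> is_line L \<and> is_line M \<and>
     (\<forall>T :: real^2 \<Rightarrow> real^2. linear T \<and> bij T \<and> T ` E = cball 0 1 \<longrightarrow> orthogonal_lines (T ` L) (T ` M))"

lemma ellipse_norm_eq:
  fixes T :: "real^2 \<Rightarrow> real^2"
  assumes T: "linear T" "bij T"
  shows "ellipse_norm (T -` cball 0 1) x = norm (T x)"
proof -
  have mem: "x \<in> (\<lambda>y. r *\<^sub>R y) ` (T -` cball 0 1) \<longleftrightarrow> norm (T x) \<le> r" if r: "r > 0" for r
  proof
    assume "x \<in> (\<lambda>y. r *\<^sub>R y) ` (T -` cball 0 1)"
    then obtain y where "x = r *\<^sub>R y" "y \<in> T -` cball 0 1" by blast
    then show "norm (T x) \<le> r"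
      using r T(1) by (simp add: linear_scale mult_left_le)
  next
    assume le: "norm (T x) \<le> r"
    show "x \<in> (\<lambda>y. r *\<^sub>R y) ` (T -` cball 0 1)"
    proof (rule image_eqI)
      show "x = r *\<^sub>R (inverse r *\<^sub>R x)" using r by simp
      show "inverse r *\<^sub>R x \<in> T -` cball 0 1"
        using r le T(1) by (simp add: linear_scale field_simps)
    qed
  qed
  have eq: "{r. r > 0 \<and> x \<in> (\<lambda>y. r *\<^sub>R y) ` (T -` cball 0 1)} = {r. r > 0 \<and> norm (T x) \<le> r}"
    using mem by blast
  show ?thesis
    unfolding ellipse_norm_def eq
  proof (rule cInf_eq)
    show "norm (T x) \<le> r" if "r \<in> {r. r > 0 \<and> norm (T x) \<le> r}" for r using that by simp
    show "z \<le> norm (T x)" if le: "\<And>r. r \<in> {r. r > 0 \<and> norm (T x) \<le> r} \<Longrightarrow> z \<le> r" for z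
    proof (rule field_le_epsilon)
      fix e :: real assume "e > 0"
      moreover have "norm (T x) + e > 0" using \<open>e > 0\<close> by (simp add: add_nonneg_pos)
      ultimately show "z \<le> norm (T x) + e" by (intro le) simp
    qed
  qed
qed

text \<open>
  Positivity and finiteness of \<open>hull_dist E B\<close> hold for every compact nonconvex \<open>B\<close>;
  without them a nonconvex set may satisfy \<open>hull_dist E B = 0\<close> (a segment with an interior point
  removed) or \<open>hull_dist E B = \<infinity>\<close> (powers of two on a line).
\<close>

lemma hull_dist_pos_if_closed:
  assumes E: "centered_ellipse E" and B: "closed B" "\<not> convex B"
  shows "0 < hull_dist E B"
proof -
  obtain T :: "real^2 \<Rightarrow> real^2" where T: "linear T" "bij T" and E_eq: "E = T -` cball 0 1"
    using E unfolding centered_ellipse_def by blast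
  obtain x where x: "x \<in> convex hull B" "x \<notin> B"
    using B(2) by (metis convex_convex_hull hull_subset subsetI subset_antisym)
  obtain e where e: "e > 0" "\<And>y. dist y x < e \<Longrightarrow> y \<notin> B"
    using B(1) x(2) by (metis closed_def open_dist ComplD ComplI)
  obtain c where c: "c > 0" "\<And>y. norm (T y) \<ge> c * norm y"
    using linear_inj_bounded_below_pos[OF T(1) bij_is_inj[OF T(2)]] by (metis mult.commute)
  have "ereal (c * e) \<le> ereal (ellipse_norm E (x - s))" if "s \<in> B" for s
  proof -
    have "e \<le> norm (x - s)" using e(2)[of s] that by (metis dist_norm dist_commute not_less)
    then have "c * e \<le> c * norm (x - s)" using c(1) by simp
    also have "\<dots> \<le> norm (T (x - s))" by (rule c(2))
    finally show ?thesis by (simp add: E_eq ellipse_norm_eq[OF T])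
  qed
  then have "ereal (c * e) \<le> (INF s\<in>B. ereal (ellipse_norm E (x - s)))" by (rule INF_greatest)
  also have "\<dots> \<le> hull_dist E B" unfolding hull_dist_def by (rule SUP_upper[OF x(1)])
  finally show ?thesis using c(1) e(1) by (metis ereal_less(2) less_le_trans mult_pos_pos)
qed

lemma hull_dist_finite_if_bounded:
  assumes E: "centered_ellipse E" and B: "bounded B" "B \<noteq> {}"
  shows "hull_dist E B < \<infinity>"
proof -
  obtain T :: "real^2 \<Rightarrow> real^2" where T: "linear T" "bij T" and E_eq: "E = T -` cball 0 1"
    using E unfolding centered_ellipse_def by blast
  obtain b where b: "b \<in> B" using B(2) by blast
  have "bounded (T ` (convex hull B))"
    using B(1) T(1) by (simp add: bounded_convex_hull bounded_linear_image linear_conv_bounded_linear)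
  then obtain M where M: "\<And>x. x \<in> convex hull B \<Longrightarrow> norm (T x) \<le> M"
    unfolding bounded_iff by blast
  have "hull_dist E B \<le> ereal (M + M)"
    unfolding hull_dist_def
  proof (rule SUP_least)
    fix x assume x: "x \<in> convex hull B"
    have "norm (T (x - b)) \<le> M + M"
      using M[OF x] M[OF hull_inc[OF b]] norm_triangle_ineq4[of "T x" "T b"]
      by (simp add: linear_diff[OF T(1)])
    then show "(INF s\<in>B. ereal (ellipse_norm E (x - s))) \<le> ereal (M + M)"
      by (intro INF_lower2[OF b]) (simp add: E_eq ellipse_norm_eq[OF T])
  qed
  then show ?thesis using ereal_infty_less(1) le_less_trans by fastforce
qed

end

theory Submission
  imports Defs
begin

text \<open>
  Choosing \<open>T\<close> with \<open>E = T -` cball 0 1\<close> turns the norm of \<open>E\<close> into the Euclidean norm, so let \<open>E\<close>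
  be the unit disc. If \<open>B\<close> is not two-dimensional, it lies on a line with unit direction \<open>v\<close>, and
  the distance \<open>d\<close> of \<open>B\<close> from its hull is half the supremum of the lengths of the gaps of \<open>B\<close>
  (\<open>gap_around_hull_point\<close>). A point of \<open>conv (A + B)\<close> has the form \<open>a + t\<close> with \<open>a \<in> A\<close> and
  \<open>t \<in> conv B\<close>. The points \<open>a + b\<close> with \<open>b \<in> B\<close> come within about \<open>d\<close> of it, and fail to come
  closer only if \<open>t\<close> is nearly the midpoint of a gap of nearly maximal length.

  Suppose that two points of \<open>A\<close> differ in the \<open>v\<close> direction. Then \<open>a\<close> can be moved inside the
  convex set \<open>A\<close> with a nonzero \<open>v\<close> component, in one of the two senses. Near a midpoint both ends
  of the gap are available, so the end is chosen from which the shift points towards \<open>t\<close>, and the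
  distance decreases to first order in the length of the shift, while the component across \<open>v\<close>
  costs only second order. As \<open>A\<close> and \<open>B\<close> need be neither closed nor bounded, a decrease of the
  supremum requires a gain uniform in \<open>a\<close>. It comes from shifts whose slope against \<open>v\<close> is bounded
  and whose \<open>v\<close> component is bounded away from zero. These are supplied by \<open>uniform_shift\<close>, and \<open>hull_dist_drops\<close> draws the conclusion.

  Hence equality of the two distances forces all differences of points of \<open>A\<close> to be orthogonal
  to \<open>v\<close>, so \<open>A\<close> spans a line orthogonal to that of \<open>B\<close>.
\<close>

section \<open>Shifts inside a convex set with uniformly bounded slope\<close>

text \<open>
  If \<open>S\<close> is bounded above, \<open>s0\<close> itself is close enough to every \<open>s\<close>. Otherwise \<open>s\<close> is reached
  exactly from some \<open>z\<close> at more than twice its distance from \<open>s0\<close>. The restriction to the first half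
  of the segment from \<open>s0\<close> to \<open>z\<close> is what \<open>uniform_shift\<close> relies on.
\<close>

lemma near_halfway_above:
  fixes S :: "real set"
  assumes "s0 \<in> S"
  shows "\<exists>C\<ge>0. \<forall>s\<in>S. s0 \<le> s \<longrightarrow> (\<exists>z\<in>S. \<exists>\<tau>. 0 \<le> \<tau> \<and> \<tau> \<le> 1/2 \<and> \<bar>s0 + \<tau> * (z - s0) - s\<bar> \<le> C)"
proof (cases "bdd_above S")
  case True
  then obtain M where M: "\<And>s. s \<in> S \<Longrightarrow> s \<le> M" by (auto simp: bdd_above_def)
  show ?thesis
  proof (intro exI[of _ "M - s0"] conjI ballI impI)
    show "0 \<le> M - s0" using M[OF assms] by simp
    fix s assume "s \<in> S" "s0 \<le> s"
    then show "\<exists>z\<in>S. \<exists>\<tau>. 0 \<le> \<tau> \<and> \<tau> \<le> 1/2 \<and> \<bar>s0 + \<tau> * (z - s0) - s\<bar> \<le> M - s0"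
      using M[of s] by (intro bexI[OF _ assms] exI[of _ 0]) auto
  qed
next
  case False
  have "\<exists>z\<in>S. \<exists>\<tau>. 0 \<le> \<tau> \<and> \<tau> \<le> 1/2 \<and> \<bar>s0 + \<tau> * (z - s0) - s\<bar> \<le> 0" if "s0 \<le> s" for s
  proof -
    obtain z where z: "z \<in> S" "2 * s - s0 + 1 < z"
      using False by (meson bdd_above.I not_le)
    have "0 < z - s0" using z(2) that by linarith
    then show ?thesis
      using z that by (intro bexI[OF _ z(1)] exI[of _ "(s - s0) / (z - s0)"]) (auto simp: field_simps)
  qed
  then show ?thesis by (intro exI[of _ 0]) auto
qed

lemma near_halfway:
  fixes S :: "real set"
  assumes "s0 \<in> S"
  shows "\<exists>C\<ge>0. \<forall>s\<in>S. \<exists>z\<in>S. \<exists>\<tau>. 0 \<le> \<tau> \<and> \<tau> \<le> 1/2 \<and> \<bar>s0 + \<tau> * (z - s0) - s\<bar> \<le> C"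
proof -
  obtain C1 where C1: "C1 \<ge> 0" "\<And>s. s \<in> S \<Longrightarrow> s0 \<le> s \<Longrightarrow>
      \<exists>z\<in>S. \<exists>\<tau>. 0 \<le> \<tau> \<and> \<tau> \<le> 1/2 \<and> \<bar>s0 + \<tau> * (z - s0) - s\<bar> \<le> C1"
    using near_halfway_above[OF assms] by metis
  have "- s0 \<in> uminus ` S" using assms by simp
  from near_halfway_above[OF this] obtain C2 where C2: "C2 \<ge> 0" "\<And>s. s \<in> S \<Longrightarrow> s \<le> s0 \<Longrightarrow>
      \<exists>z\<in>S. \<exists>\<tau>. 0 \<le> \<tau> \<and> \<tau> \<le> 1/2 \<and> \<bar>- s0 + \<tau> * (- z - - s0) - - s\<bar> \<le> C2"
    by force
  have flip: "\<bar>- s0 + \<tau> * (- z - - s0) - - s\<bar> = \<bar>s0 + \<tau> * (z - s0) - s\<bar>" for \<tau> z s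
  proof -
    have "- s0 + \<tau> * (- z - - s0) - - s = - (s0 + \<tau> * (z - s0) - s)" by (simp add: algebra_simps)
    then show ?thesis by (simp only: abs_minus)
  qed
  show ?thesis
  proof (intro exI[of _ "max C1 C2"] conjI ballI)
    show "0 \<le> max C1 C2" using C1(1) by simp
    fix s assume s: "s \<in> S"
    show "\<exists>z\<in>S. \<exists>\<tau>. 0 \<le> \<tau> \<and> \<tau> \<le> 1/2 \<and> \<bar>s0 + \<tau> * (z - s0) - s\<bar> \<le> max C1 C2"
    proof (cases "s0 \<le> s")
      case True
      then show ?thesis using C1(2)[OF s] by (meson max.coboundedI1)
    next
      case False
      then show ?thesis using C2(2)[OF s, unfolded flip] by (meson max.coboundedI2 linear)
    qed
  qed
qed

text \<open>
  The difficulty is that \<open>A\<close> may be unbounded in the direction of \<open>w\<close>, so that the directions from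
  \<open>a\<close> to the given points \<open>x\<close> and \<open>y\<close> can become parallel to \<open>w\<close>. Contracting \<open>x\<close> and \<open>y\<close> by the
  same ratio towards a suitable \<open>z \<in> A\<close> brings both to about the \<open>w\<close> coordinate of \<open>a\<close>. By
  \<open>near_halfway\<close> a ratio of at most one half suffices, so at least half of the \<open>v\<close> component of
  \<open>x - y\<close> survives, and one of the two contracted points is at a fixed distance from \<open>a\<close> in the
  direction of \<open>v\<close>.
\<close>

lemma uniform_shift:
  fixes A :: "'a::real_inner set"
  assumes "convex A" "x \<in> A" "y \<in> A" "(x - y) \<bullet> v \<noteq> 0"
  shows "\<exists>c>0. \<exists>C\<ge>0. \<forall>a\<in>A. \<exists>q\<in>A. c \<le> \<bar>(q - a) \<bullet> v\<bar> \<and> \<bar>(q - a) \<bullet> w\<bar> \<le> C"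
proof -
  define c where "c = \<bar>(x - y) \<bullet> v\<bar> / 4"
  have c: "c > 0" using assms(4) by (simp add: c_def)
  have "x \<bullet> w \<in> (\<lambda>a. a \<bullet> w) ` A" using assms(2) by blast
  from near_halfway[OF this] obtain C where C: "C \<ge> 0" "\<And>a. a \<in> A \<Longrightarrow>
      \<exists>z\<in>A. \<exists>\<tau>. 0 \<le> \<tau> \<and> \<tau> \<le> 1/2 \<and> \<bar>x \<bullet> w + \<tau> * (z \<bullet> w - x \<bullet> w) - a \<bullet> w\<bar> \<le> C"
    by (auto simp: Ball_def Bex_def image_iff) metis
  define C' where "C' = C + \<bar>(x - y) \<bullet> w\<bar>"
  show ?thesis
  proof (rule exI[of _ c], intro exI[of _ C'] conjI c ballI)
    show "0 \<le> C'" using C(1) by (simp add: C'_def)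
    fix a assume a: "a \<in> A"
    obtain z \<tau> where z: "z \<in> A" and \<tau>: "0 \<le> \<tau>" "\<tau> \<le> 1/2"
      and close: "\<bar>x \<bullet> w + \<tau> * (z \<bullet> w - x \<bullet> w) - a \<bullet> w\<bar> \<le> C"
      using C(2)[OF a] by blast
    define x' where "x' = (1 - \<tau>) *\<^sub>R x + \<tau> *\<^sub>R z"
    define y' where "y' = (1 - \<tau>) *\<^sub>R y + \<tau> *\<^sub>R z"
    have mem: "x' \<in> A" "y' \<in> A"
      unfolding x'_def y'_def using assms(1-3) z \<tau> by (auto intro!: convexD)
    have xw: "\<bar>(x' - a) \<bullet> w\<bar> \<le> C"
      using close by (simp add: x'_def inner_simps algebra_simps)
    have diff: "x' - y' = (1 - \<tau>) *\<^sub>R (x - y)" by (simp add: x'_def y'_def algebra_simps)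
    have "\<bar>(x' - y') \<bullet> w\<bar> = (1 - \<tau>) * \<bar>(x - y) \<bullet> w\<bar>"
      unfolding diff using \<tau> by (simp add: abs_mult)
    also have "\<dots> \<le> \<bar>(x - y) \<bullet> w\<bar>" using \<tau> by (intro mult_left_le_one_le) auto
    finally have yw: "\<bar>(y' - a) \<bullet> w\<bar> \<le> C'"
      using xw unfolding C'_def inner_diff_left by linarith
    have "\<bar>(x' - y') \<bullet> v\<bar> = (1 - \<tau>) * \<bar>(x - y) \<bullet> v\<bar>"
      unfolding diff using \<tau> by (simp add: abs_mult)
    moreover have "1/2 * \<bar>(x - y) \<bullet> v\<bar> \<le> (1 - \<tau>) * \<bar>(x - y) \<bullet> v\<bar>"
      using \<tau> by (intro mult_right_mono) auto
    ultimately have "2 * c \<le> \<bar>(x' - y') \<bullet> v\<bar>" by (simp add: c_def)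
    then have "c \<le> \<bar>(x' - a) \<bullet> v\<bar> \<or> c \<le> \<bar>(y' - a) \<bullet> v\<bar>"
      unfolding inner_diff_left by linarith
    then show "\<exists>q\<in>A. c \<le> \<bar>(q - a) \<bullet> v\<bar> \<and> \<bar>(q - a) \<bullet> w\<bar> \<le> C'"
      using mem xw yw by (auto simp: C'_def intro: order_trans)
  qed
qed

section \<open>Gaps of a subset of a line\<close>

text \<open>
  The supremum of the points of \<open>S\<close> up to \<open>t\<close> and the infimum of those from \<open>t\<close> on are the ends of a
  gap of \<open>S\<close>, whose midpoint lies in the hull and is half the length of the gap away from \<open>S\<close>. The
  ends need not belong to \<open>S\<close>, so \<open>l\<close> and \<open>m\<close> only approximate them, which costs \<open>\<epsilon>\<close>.
\<close>

lemma gap_around_hull_point: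
  fixes S :: "real set"
  assumes near: "\<And>u \<eta>. u \<in> convex hull S \<Longrightarrow> \<eta> > 0 \<Longrightarrow> \<exists>s\<in>S. \<bar>u - s\<bar> < d + \<eta>"
    and t: "t \<in> convex hull S" and "\<epsilon> > 0"
  obtains l m where "l \<in> S" "m \<in> S" "l \<le> t" "t \<le> m" "m - l \<le> 2 * d + \<epsilon>"
proof -
  define L where "L = {s\<in>S. s \<le> t}"
  define R where "R = {s\<in>S. t \<le> s}"
  have "\<not> S \<subseteq> {t<..}" using t hull_minimal[of S "{t<..}" convex] by auto
  then obtain l0 where l0: "l0 \<in> L" unfolding L_def by (auto simp: subset_iff not_less)
  have "\<not> S \<subseteq> {..<t}" using t hull_minimal[of S "{..<t}" convex] by auto
  then obtain m0 where m0: "m0 \<in> R" unfolding R_def by (auto simp: subset_iff not_less)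
  have bL: "bdd_above L" unfolding L_def by (auto intro!: bdd_aboveI[of _ t])
  have bR: "bdd_below R" unfolding R_def by (auto intro!: bdd_belowI[of _ t])
  have L: "l0 \<le> Sup L" "Sup L \<le> t" "\<And>s. s \<in> L \<Longrightarrow> s \<le> Sup L"
    using l0 bL by (auto intro!: cSup_upper cSup_least simp: L_def)
  have R: "Inf R \<le> m0" "t \<le> Inf R" "\<And>s. s \<in> R \<Longrightarrow> Inf R \<le> s"
    using m0 bR by (auto intro!: cInf_lower cInf_greatest simp: R_def)
  define u where "u = (Sup L + Inf R) / 2"
  define \<eta> where "\<eta> = \<epsilon> / 4"
  have \<eta>: "\<eta> > 0" using \<open>\<epsilon> > 0\<close> by (simp add: \<eta>_def)
  have "u \<in> closed_segment l0 m0"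
    using L(1,2) R(1,2) by (auto simp: u_def closed_segment_eq_real_ivl)
  moreover have "closed_segment l0 m0 \<subseteq> convex hull S"
    using l0 m0 by (intro closed_segment_subset) (auto simp: L_def R_def intro: hull_inc)
  ultimately obtain s where s: "s \<in> S" "\<bar>u - s\<bar> < d + \<eta>" using near[OF _ \<eta>] by blast
  have gap: "Inf R - Sup L < 2 * (d + \<eta>)"
  proof (cases "s \<le> t")
    case True
    then have "s \<le> Sup L" using s(1) L(3) by (simp add: L_def)
    then show ?thesis using s(2) by (simp add: u_def field_simps abs_if split: if_splits)
  next
    case False
    then have "Inf R \<le> s" using s(1) R(3) by (simp add: R_def)
    then show ?thesis using s(2) by (simp add: u_def field_simps abs_if split: if_splits)
  qed
  obtain l where l: "l \<in> L" "Sup L - \<eta> < l"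
    using less_cSup_iff[of L "Sup L - \<eta>"] l0 bL \<eta> by auto
  obtain m where m: "m \<in> R" "m < Inf R + \<eta>"
    using cInf_less_iff[of R "Inf R + \<eta>"] m0 bR \<eta> by auto
  show ?thesis
  proof (rule that[of l m])
    show "m - l \<le> 2 * d + \<epsilon>" using l(2) m(2) gap by (simp add: \<eta>_def)
  qed (use l m in \<open>auto simp: L_def R_def\<close>)
qed

section \<open>Decrease of the distance from the hull\<close>

lemma norm_sq_orthonormal_pair:
  fixes x v w :: "real^2"
  assumes "norm v = 1" "norm w = 1" "v \<bullet> w = 0"
  shows "(norm x)\<^sup>2 = (x \<bullet> v)\<^sup>2 + (x \<bullet> w)\<^sup>2"
proof -
  have v: "(v$1)\<^sup>2 + (v$2)\<^sup>2 = 1" and w: "(w$1)\<^sup>2 + (w$2)\<^sup>2 = 1" and o: "v$1 * w$1 + v$2 * w$2 = 0"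
    using assms by (simp_all add: norm_eq_1 inner_vec_def sum_2 power2_eq_square)
  have "(v$1)\<^sup>2 = (w$2)\<^sup>2" "(v$2)\<^sup>2 = (w$1)\<^sup>2" "v$1 * v$2 + w$1 * w$2 = 0"
    using v w o by algebra+
  then have "(x$1)\<^sup>2 + (x$2)\<^sup>2 = (x$1 * v$1 + x$2 * v$2)\<^sup>2 + (x$1 * w$1 + x$2 * w$2)\<^sup>2"
    using v w o by algebra
  then show ?thesis
    unfolding power2_norm_eq_inner by (simp add: inner_vec_def sum_2 power2_eq_square)
qed

text \<open>
  For a point \<open>a + t\<close> with \<open>t\<close> at distance \<open>r\<close> from the chosen end of its gap, a shift of \<open>a\<close> with
  \<open>v\<close> component \<open>\<mu>\<close> towards \<open>t\<close> and slope at most \<open>C / c\<close> leaves a squared distance of at most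
  \<open>(r - \<mu>)\<^sup>2 + \<mu>\<^sup>2 * (C / c)\<^sup>2 = r\<^sup>2 - 2 * r * \<mu> + \<mu>\<^sup>2 * K\<close>, where \<open>K = 1 + (C / c)\<^sup>2\<close>. With
  \<open>\<mu> \<le> d / (2 * K)\<close> and \<open>r\<close> within \<open>2 * e\<close> of \<open>d\<close>, the linear term outweighs both the quadratic one
  and the excess of \<open>r\<close> over \<open>d\<close>.
\<close>

lemma hull_dist_drops:
  fixes A :: "(real^2) set" and S :: "real set" and b0 v :: "real^2"
  defines "B \<equiv> (\<lambda>s. b0 + s *\<^sub>R v) ` S"
  assumes A: "convex A" "x \<in> A" "y \<in> A" "(x - y) \<bullet> v \<noteq> 0"
    and v: "norm v = 1" and d: "d > 0"
    and near: "\<And>u \<eta>. u \<in> convex hull B \<Longrightarrow> \<eta> > 0 \<Longrightarrow> \<exists>b\<in>B. norm (u - b) < d + \<eta>"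
  shows "\<exists>d'<d. \<forall>z\<in>convex hull (A + B). \<exists>s\<in>A + B. norm (z - s) \<le> d'"
proof -
  define w :: "real^2" where "w = vector [- v$2, v$1]"
  have vw: "norm w = 1" "v \<bullet> w = 0"
    using v by (simp_all add: w_def norm_eq_1 inner_vec_def sum_2 algebra_simps)
  obtain c C where c: "c > 0" and C: "C \<ge> 0"
    and shift: "\<And>a. a \<in> A \<Longrightarrow> \<exists>q\<in>A. c \<le> \<bar>(q - a) \<bullet> v\<bar> \<and> \<bar>(q - a) \<bullet> w\<bar> \<le> C"
    using uniform_shift[OF A, of w] by metis
  define K where "K = 1 + (C / c)\<^sup>2"
  have K: "K \<ge> 1" by (simp add: K_def)
  define \<mu> where "\<mu> = min c (d / (2 * K))"
  have \<mu>: "\<mu> > 0" "\<mu> \<le> c" "\<mu> * K \<le> d / 2"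
  proof -
    show "\<mu> > 0" "\<mu> \<le> c" using c d K by (auto simp: \<mu>_def)
    have "\<mu> * K \<le> d / (2 * K) * K" using K by (intro mult_right_mono) (auto simp: \<mu>_def)
    then show "\<mu> * K \<le> d / 2" using K by simp
  qed
  have "\<mu> * 1 \<le> \<mu> * K" using \<mu>(1) K by (intro mult_left_mono) auto
  then have \<mu>d: "\<mu> \<le> d / 2" using \<mu>(3) by simp
  (* The tolerance e makes 6 * d * e, which bounds the excess of (d + 2 * e)^2 over d^2, half of
     the gain d * mu / 2. *)
  define e where "e = \<mu> / 24"
  have e: "e > 0" "e \<le> d / 48" using \<mu>(1) \<mu>d by (auto simp: e_def)
  define d' where "d' = max (d - e) (sqrt (d\<^sup>2 - d * \<mu> / 4))"
  have "sqrt (d\<^sup>2 - d * \<mu> / 4) < sqrt (d\<^sup>2)"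
    using d \<mu>(1) by (intro real_sqrt_less_mono) simp
  then have "d' < d" using d e by (simp add: d'_def)
  have convB: "convex hull B = (\<lambda>s. b0 + s *\<^sub>R v) ` (convex hull S)"
  proof -
    have "linear (\<lambda>s::real. s *\<^sub>R v)" by (simp add: linear_iff scaleR_add_left)
    then have "convex hull ((\<lambda>s. s *\<^sub>R v) ` S) = (\<lambda>s. s *\<^sub>R v) ` (convex hull S)"
      by (rule convex_hull_linear_image[symmetric])
    then have "convex hull ((\<lambda>z. b0 + z) ` (\<lambda>s. s *\<^sub>R v) ` S) = (\<lambda>z. b0 + z) ` (\<lambda>s. s *\<^sub>R v) ` (convex hull S)"
      by (simp only: convex_hull_translation)
    then show ?thesis by (simp add: B_def image_image)
  qed
  have nearS: "\<exists>s\<in>S. \<bar>u - s\<bar> < d + \<eta>" if "u \<in> convex hull S" "\<eta> > 0" for u \<eta>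
  proof -
    have "\<exists>s\<in>S. norm ((b0 + u *\<^sub>R v) - (b0 + s *\<^sub>R v)) < d + \<eta>"
    proof -
      have "b0 + u *\<^sub>R v \<in> convex hull B" unfolding convB using that(1) by (rule imageI)
      from near[OF this that(2)] show ?thesis by (simp add: B_def)
    qed
    then obtain s where "s \<in> S" "norm ((b0 + u *\<^sub>R v) - (b0 + s *\<^sub>R v)) < d + \<eta>" ..
    moreover have "(b0 + u *\<^sub>R v) - (b0 + s *\<^sub>R v) = (u - s) *\<^sub>R v" by (simp add: algebra_simps)
    ultimately show ?thesis using v by auto
  qed
  have "\<exists>s\<in>A + B. norm (z - s) \<le> d'" if z: "z \<in> convex hull (A + B)" for z
  proof -
    have "z \<in> A + convex hull B"
      using z A(1) by (simp add: convex_hull_set_plus hull_same)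
    then obtain a t where a: "a \<in> A" and t: "t \<in> convex hull S" and z_eq: "z = a + (b0 + t *\<^sub>R v)"
      by (auto simp: convB elim!: set_plus_elim)
    obtain l m where lm: "l \<in> S" "m \<in> S" "l \<le> t" "t \<le> m" "m - l \<le> 2 * d + e"
      using gap_around_hull_point[OF nearS t e(1)] by blast
    have cand: "\<exists>s\<in>A + B. norm (z - s) \<le> d'"
      if "q \<in> A" "s \<in> S" "norm ((t - s) *\<^sub>R v - (q - a)) \<le> d'" for q s
    proof (rule bexI)
      show "q + (b0 + s *\<^sub>R v) \<in> A + B" using that by (auto simp: B_def intro!: set_plus_intro)
      have "z - (q + (b0 + s *\<^sub>R v)) = (t - s) *\<^sub>R v - (q - a)" by (simp add: z_eq algebra_simps)
      then show "norm (z - (q + (b0 + s *\<^sub>R v))) \<le> d'" using that(3) by (simp only:)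
    qed
    have d'1: "d - e \<le> d'" and d'2: "sqrt (d\<^sup>2 - d * \<mu> / 4) \<le> d'" by (auto simp: d'_def)
    (* If one end of the gap is within distance d - e, then a needs no shift. Otherwise the bound on the
       length of the gap places both ends at distance at most d + 2 * e. *)
    consider "t - l \<le> d - e" | "m - t \<le> d - e" | "t - l > d - e" "m - t > d - e" by linarith
    then show ?thesis
    proof cases
      case 1
      then show ?thesis using cand[OF a lm(1)] lm(3) v d'1 by simp
    next
      case 2
      then show ?thesis using cand[OF a lm(2)] lm(4) v d'1 by simp
    next
      case 3
      obtain q where q: "q \<in> A" "c \<le> \<bar>(q - a) \<bullet> v\<bar>" "\<bar>(q - a) \<bullet> w\<bar> \<le> C" using shift[OF a] by blast
      define \<sigma> where "\<sigma> = (q - a) \<bullet> v"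
      define s where "s = (if \<sigma> > 0 then l else m)"
      define r where "r = \<bar>t - s\<bar>"
      have \<sigma>: "c \<le> \<bar>\<sigma>\<bar>" "\<sigma> \<noteq> 0" using q(2) c by (auto simp: \<sigma>_def)
      have s: "s \<in> S" using lm by (simp add: s_def)
      have sgn: "t - s = sgn \<sigma> * r"
        using lm(3,4) \<sigma>(2) by (auto simp: s_def r_def sgn_if)
      have r: "d - e \<le> r" "r \<le> d + 2 * e"
        using 3 lm(3,4,5) by (auto simp: s_def r_def)
      (* This fraction of q - a has v component exactly mu in absolute value, so the shift stays
         small however far q is from a. *)
      define lam where "lam = \<mu> / \<bar>\<sigma>\<bar>"
      have lam: "0 \<le> lam" "lam \<le> 1" "lam \<le> \<mu> / c"
        using \<mu>(1,2) \<sigma> c by (auto simp: lam_def field_simps intro: frac_le)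
      define q' where "q' = (1 - lam) *\<^sub>R a + lam *\<^sub>R q"
      have q': "q' \<in> A" using A(1) a q(1) lam by (auto simp: q'_def intro!: convexD)
      have q'a: "q' - a = lam *\<^sub>R (q - a)" by (simp add: q'_def algebra_simps)
      define p where "p = (t - s) *\<^sub>R v - (q' - a)"
      have "v \<bullet> v = 1" using v by (simp add: norm_eq_1)
      then have "p \<bullet> v = t - s - lam * \<sigma>"
        unfolding p_def q'a \<sigma>_def by (simp only: inner_diff_left[of "(t - s) *\<^sub>R v"] inner_scaleR_left) simp
      also have "lam * \<sigma> = sgn \<sigma> * \<mu>" using \<sigma>(2) by (simp add: lam_def sgn_if)
      finally have "p \<bullet> v = sgn \<sigma> * (r - \<mu>)" by (simp add: sgn algebra_simps)
      then have pv: "(p \<bullet> v)\<^sup>2 = (r - \<mu>)\<^sup>2" using \<sigma>(2) by (simp add: power_mult_distrib sgn_if)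
      have "p \<bullet> w = - (lam * ((q - a) \<bullet> w))"
        unfolding p_def q'a using vw(2)
        by (simp only: inner_diff_left[of "(t - s) *\<^sub>R v"] inner_scaleR_left)
      then have "\<bar>p \<bullet> w\<bar> = lam * \<bar>(q - a) \<bullet> w\<bar>" using lam(1) by (simp add: abs_mult)
      also have "\<dots> \<le> \<mu> / c * C" using lam q(3) c \<mu>(1) by (intro mult_mono) auto
      finally have "\<bar>p \<bullet> w\<bar>\<^sup>2 \<le> (\<mu> / c * C)\<^sup>2" by (rule power_mono) simp
      then have pw: "(p \<bullet> w)\<^sup>2 \<le> \<mu>\<^sup>2 * (C / c)\<^sup>2" by (simp add: power_mult_distrib power_divide)
      have "(norm p)\<^sup>2 \<le> (r - \<mu>)\<^sup>2 + \<mu>\<^sup>2 * (C / c)\<^sup>2"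
        using norm_sq_orthonormal_pair[OF v vw, of p] pv pw by simp
      also have "\<dots> = r\<^sup>2 - 2 * r * \<mu> + \<mu> * (\<mu> * K)"
        by (simp add: K_def power2_eq_square algebra_simps)
      also have "\<dots> \<le> (d + 2 * e)\<^sup>2 - d * \<mu> + \<mu> * (d / 2)"
      proof -
        have "r\<^sup>2 \<le> (d + 2 * e)\<^sup>2" using r e d by (intro power_mono) auto
        moreover have "d * \<mu> \<le> (2 * r) * \<mu>" using r e d \<mu>(1) by (intro mult_right_mono) auto
        moreover have "\<mu> * (\<mu> * K) \<le> \<mu> * (d / 2)" using \<mu> by (intro mult_left_mono) auto
        ultimately show ?thesis by linarith
      qed
      also have "\<dots> \<le> d\<^sup>2 - d * \<mu> / 4"
      proof -
        have "e * e \<le> d / 2 * e" using e d by (intro mult_right_mono) auto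
        then have "(d + 2 * e)\<^sup>2 \<le> d\<^sup>2 + 6 * (d * e)" by (simp add: power2_eq_square algebra_simps)
        also have "6 * (d * e) = d * \<mu> / 4" by (simp add: e_def)
        finally show ?thesis by (simp add: algebra_simps)
      qed
      finally have "norm p \<le> sqrt (d\<^sup>2 - d * \<mu> / 4)" by (rule real_le_rsqrt)
      then show ?thesis using cand[OF q' s] d'2 by (simp add: p_def)
    qed
  qed
  then show ?thesis using \<open>d' < d\<close> by blast
qed

text \<open>
  The map \<open>T\<close> carries hulls to hulls, sums to sums and the norm of \<open>E\<close> to the Euclidean norm, so the
  uniform gain for \<open>T ` A\<close> and \<open>T ` B\<close> would contradict the equality of the two distances.
\<close>

lemma orthogonal_if_hull_dist_eq:
  fixes T :: "real^2 \<Rightarrow> real^2" and A B :: "(real^2) set"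
  assumes T: "linear T" "bij T" and E: "E = T -` cball 0 1"
    and A: "convex A" "x \<in> A" "y \<in> A"
    and B: "B \<subseteq> range (\<lambda>s. b0 + s *\<^sub>R u)" and u: "u \<noteq> 0"
    and d: "0 < hull_dist E B" "hull_dist E B < \<infinity>"
    and eq: "hull_dist E (A + B) = hull_dist E B"
  shows "T (x - y) \<bullet> T u = 0"
proof (rule ccontr)
  assume nz: "T (x - y) \<bullet> T u \<noteq> 0"
  obtain d where dd: "hull_dist E B = ereal d" "d > 0"
    using d by (cases "hull_dist E B") auto
  have N: "ellipse_norm E z = norm (T z)" for z unfolding E by (rule ellipse_norm_eq[OF T])
  have Tu: "norm (T u) > 0" using u T by (metis bij_is_inj linear_injective_0 zero_less_norm_iff)
  define v where "v = T u /\<^sub>R norm (T u)"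
  have v: "norm v = 1" using Tu by (simp add: v_def)
  define S where "S = {s. T b0 + s *\<^sub>R v \<in> T ` B}"
  have TB: "T ` B = (\<lambda>s. T b0 + s *\<^sub>R v) ` S"
  proof (intro equalityI subsetI)
    fix b' assume b': "b' \<in> T ` B"
    then obtain b where b: "b \<in> B" "b' = T b" by blast
    obtain s where "b = b0 + s *\<^sub>R u" using B b(1) by blast
    then have "b' = T b0 + (s * norm (T u)) *\<^sub>R v"
      using b(2) Tu T(1) by (simp add: linear_add linear_scale v_def)
    then show "b' \<in> (\<lambda>s. T b0 + s *\<^sub>R v) ` S" using b' unfolding S_def by blast
  qed (auto simp: S_def)
  have near: "\<exists>b\<in>T ` B. norm (z - b) < d + \<eta>" if z: "z \<in> convex hull (T ` B)" and \<eta>: "\<eta> > 0" for z \<eta>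
  proof -
    obtain z0 where z0: "z0 \<in> convex hull B" "z = T z0"
      using z convex_hull_linear_image[OF T(1), of B] by auto
    have "(INF s\<in>B. ereal (ellipse_norm E (z0 - s))) \<le> ereal d"
      unfolding dd(1)[symmetric] hull_dist_def by (rule SUP_upper[OF z0(1)])
    also have "\<dots> < ereal (d + \<eta>)" using \<eta> by simp
    finally obtain b where "b \<in> B" "norm (T (z0 - b)) < d + \<eta>" by (auto simp: INF_less_iff N)
    then show ?thesis using z0 T(1) by (auto simp: linear_diff)
  qed
  have "(T x - T y) \<bullet> v \<noteq> 0" using nz Tu T(1) by (simp add: v_def linear_diff)
  from hull_dist_drops[OF convex_linear_image[OF T(1) A(1)] imageI[OF A(2)] imageI[OF A(3)] this v dd(2),
      of "T b0" S, folded TB, OF near]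
  obtain d' where d': "d' < d"
    "\<And>z. z \<in> convex hull (T ` A + T ` B) \<Longrightarrow> \<exists>s\<in>T ` A + T ` B. norm (z - s) \<le> d'" by blast
  have sum: "T ` (A + B) = T ` A + T ` B"
    using T(1) by (force simp: set_plus_def linear_add)
  have "hull_dist E (A + B) \<le> ereal d'"
    unfolding hull_dist_def
  proof (rule SUP_least)
    fix z assume "z \<in> convex hull (A + B)"
    then have "T z \<in> convex hull (T ` A + T ` B)"
      using convex_hull_linear_image[OF T(1), of "A + B"] sum by auto
    from d'(2)[OF this] obtain s where s: "s \<in> A + B" "norm (T z - T s) \<le> d'"
      unfolding sum[symmetric] by blast
    then show "(INF s\<in>A + B. ereal (ellipse_norm E (z - s))) \<le> ereal d'"
      using T(1) by (intro INF_lower2[OF s(1)]) (simp add: N linear_diff)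
  qed
  then show False using eq dd(1) d'(1) by simp
qed

section \<open>Orthogonality of the affine hulls\<close>

theorem proposition1p1:
  fixes E A B :: "(real^2) set"
  assumes "centered_ellipse E"
    and "convex A" and "\<exists>x\<in>A. \<exists>y\<in>A. x \<noteq> y"
    and "\<not> convex B"
    and "0 < hull_dist E B" and "hull_dist E B < \<infinity>"
    and "hull_dist E (A + B) = hull_dist E B"
  shows "E_orthogonal_lines E (affine hull A) (affine hull B) \<or> aff_dim B = 2"
proof (rule disjCI)
  assume not2: "aff_dim B \<noteq> 2"
  have "\<not> aff_dim B \<le> 0"
  proof
    assume "aff_dim B \<le> 0"
    then have "aff_dim B = -1 \<or> aff_dim B = 0" using aff_dim_geq[of B] by linarith
    then have "B = {} \<or> (\<exists>b. B = {b})" by (auto simp: aff_dim_empty aff_dim_eq_0)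
    then show False using assms(4) by auto
  qed
  moreover have "aff_dim B \<le> 2" using aff_dim_le_DIM[of B] by simp
  ultimately have dimB: "aff_dim B = 1" using not2 by linarith
  then have "collinear B" by (simp add: collinear_aff_dim)
  then obtain u where u: "\<And>b b'. b \<in> B \<Longrightarrow> b' \<in> B \<Longrightarrow> \<exists>c. b - b' = c *\<^sub>R u"
    unfolding collinear_def by blast
  obtain b0 where b0: "b0 \<in> B" using assms(4) by fastforce
  have B: "\<exists>s. b = b0 + s *\<^sub>R u" if "b \<in> B" for b
    using u[OF that b0] by (metis add.commute diff_add_cancel)
  then have B_line: "B \<subseteq> range (\<lambda>s. b0 + s *\<^sub>R u)" by blast
  have "u \<noteq> 0"
  proof
    assume "u = 0"
    then have "b = b0" if "b \<in> B" for b using B[OF that] by simp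
    then have "B = {b0}" using b0 by blast
    then show False using assms(4) by simp
  qed
  have orth: "T (x - y) \<bullet> T u = 0"
    if "linear T" "bij T" "E = T -` cball 0 1" "x \<in> A" "y \<in> A" for T :: "real^2 \<Rightarrow> real^2" and x y
    using orthogonal_if_hull_dist_eq[OF that(1-3) assms(2) that(4,5) B_line \<open>u \<noteq> 0\<close> assms(5-7)] .
  obtain x0 y0 where xy: "x0 \<in> A" "y0 \<in> A" "x0 \<noteq> y0" using assms(3) by blast
  have hullA: "T (x - x0) \<bullet> T u = 0"
    if T: "linear T" "bij T" "E = T -` cball 0 1" and x: "x \<in> affine hull A"
    for T :: "real^2 \<Rightarrow> real^2" and x
  proof -
    have "affine {x. T (x - x0) \<bullet> T u = 0}"
    proof -
      have "{x. T (x - x0) \<bullet> T u = 0} = {x. adjoint T (T u) \<bullet> x = T x0 \<bullet> T u}"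
      proof -
        have "adjoint T (T u) \<bullet> x = T x \<bullet> T u" for x
          using adjoint_works[OF T(1), of x "T u"] by (simp add: inner_commute)
        then show ?thesis using T(1) by (simp add: linear_diff inner_diff_left)
      qed
      then show ?thesis by (simp add: affine_hyperplane)
    qed
    then have "affine hull A \<subseteq> {x. T (x - x0) \<bullet> T u = 0}"
      using orth[OF T _ xy(1)] by (intro hull_minimal) auto
    then show ?thesis using x by blast
  qed
  have hullB: "\<exists>s. b = b0 + s *\<^sub>R u" if "b \<in> affine hull B" for b
  proof -
    have "range (\<lambda>s. b0 + s *\<^sub>R u) = affine hull {b0, b0 + u}"
      by (auto simp: affine_hull_2_alt)
    then have "affine (range (\<lambda>s. b0 + s *\<^sub>R u))" by simp
    then have "affine hull B \<subseteq> range (\<lambda>s. b0 + s *\<^sub>R u)"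
      using B_line by (intro hull_minimal)
    then show ?thesis using that by blast
  qed
  obtain T0 :: "real^2 \<Rightarrow> real^2" where T0: "linear T0" "bij T0" "E = T0 -` cball 0 1"
    using assms(1) unfolding centered_ellipse_def by blast
  have dimA: "aff_dim A = 1"
  proof -
    have "\<not> aff_dim A \<le> 0"
      using xy aff_dim_geq[of A] aff_dim_empty[of A] aff_dim_eq_0[of A]
      by (metis empty_iff le_less linorder_not_less singletonD zle_diff1_eq diff_0 order_antisym)
    moreover have "aff_dim A \<noteq> 2"
    proof
      assume "aff_dim A = 2"
      then have "affine hull A = UNIV" using aff_dim_eq_full[of A] by simp
      then have "T0 (u + x0 - x0) \<bullet> T0 u = 0" using hullA[OF T0, of "u + x0"] by blast
      then show False using \<open>u \<noteq> 0\<close> T0(1,2) by (simp add: bij_is_inj linear_injective_0)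
                  (metis bij_is_inj linear_injective_0)
    qed
    ultimately show ?thesis using aff_dim_le_DIM[of A] by simp
  qed
  show "E_orthogonal_lines E (affine hull A) (affine hull B)"
    unfolding E_orthogonal_lines_def
  proof (intro conjI allI impI)
    show lA: "is_line (affine hull A)" and lB: "is_line (affine hull B)"
      using dimA dimB by (auto simp: is_line_def)
    fix T :: "real^2 \<Rightarrow> real^2"
    assume T: "linear T \<and> bij T \<and> T ` E = cball 0 1"
    then have ET: "E = T -` cball 0 1" by (metis bij_is_inj inj_vimage_image_eq)
    have img: "is_line (T ` L)" if "is_line L" for L
      using that T affine_hull_linear_image[of T L]
      by (auto simp: is_line_def bij_is_inj aff_dim_injective_linear_image
          linear_conv_bounded_linear hull_same affine_hull_eq[symmetric] simp del: affine_hull_eq)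
    show "orthogonal_lines (T ` (affine hull A)) (T ` (affine hull B))"
      unfolding orthogonal_lines_def
    proof (intro conjI ballI img lA lB)
      fix x y p q
      assume "x \<in> T ` (affine hull A)" "y \<in> T ` (affine hull A)"
        "p \<in> T ` (affine hull B)" "q \<in> T ` (affine hull B)"
      then obtain x' y' p' q' where xy': "x' \<in> affine hull A" "y' \<in> affine hull A" "x = T x'" "y = T y'"
        and pq': "p' \<in> affine hull B" "q' \<in> affine hull B" "p = T p'" "q = T q'" by blast
      obtain s s' where "p' = b0 + s *\<^sub>R u" "q' = b0 + s' *\<^sub>R u" using hullB pq' by metis
      then have "p - q = (s - s') *\<^sub>R T u"
        using pq' T by (simp add: linear_add linear_scale algebra_simps)
      moreover have "(x - y) \<bullet> T u = 0"
        using hullA[OF _ _ ET xy'(1)] hullA[OF _ _ ET xy'(2)] xy' T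
        by (simp add: linear_diff inner_diff_left)
      ultimately show "orthogonal (x - y) (p - q)" by (simp add: orthogonal_def)
    qed
  qed
qed

end
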